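(* Let $X$ and $Y$ be real finite-dimensional vector spaces equipped with inner products $\langle\cdot,\cdot\rangle$ and the associated norms $\|\cdot\|$, let $\mathcal{K}\subseteq Y$ be a closed and convex cone, and let $f:X\to\mathbb{R}$ and $h:X\to Y$ be continuously differentiable. Consider the problem of minimizing $f(x)$ over $x\in X$ subject to $h(x)\in\mathcal{K}$. Let $\overline{x}\in X$ be a local solution of this problem, and suppose that Robinson's condition holds at $\overline{x}$, that is, $$0\in\mathrm{int}\bigl(Dh(\overline{x})X+\mathcal{K}-h(\overline{x})\bigr).$$ Then there exists $\lambda\in Y$ such that $$\nabla f(\overline{x})+Dh(\overline{x})^*\lambda=0,\qquad \langle h(\overline{x}),\lambda\rangle=0,\qquad \lambda\in\mathcal{K}^\circ.$$
   Context: A point $\overline{x}\in X$ is a local solution of the problem if $h(\overline{x})\in\mathcal{K}$ and $f(\overline{x})\leq f(x)$ for all $x\in X$ sufficiently close to $\overline{x}$ such that $h(x)\in\mathcal{K}$. $Dh(\overline{x}):X\to Y$ is the derivative of $h$ at $\overline{x}$, $Dh(\overline{x})^*:Y\to X$ is its adjoint operator with respect to the given inner products, and $Dh(\overline{x})X$ is the image space of $Dh(\overline{x})$. The gradient $\nabla f(\overline{x})\in X$ is the unique element of $X$ such that $Df(\overline{x})d=\langle\nabla f(\overline{x}),d\rangle$ for all $d\in X$. The set $Dh(\overline{x})X+\mathcal{K}-h(\overline{x})$ is $\{Dh(\overline{x})d+w-h(\overline{x}): d\in X,\ w\in\mathcal{K}\}\subseteq Y$, and $\mathrm{int}(\cdot)$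 denotes the interior (in $Y$). The polar cone of $\mathcal{K}$ is $\mathcal{K}^\circ:=\{w\in Y:\langle w,d\rangle\leq 0\ \text{for all } d\in\mathcal{K}\}$. The element $\lambda$ is called a Lagrange multiplier. *)

theory Defs
  imports "HOL-Analysis.Analysis"
begin

text \<open>
  The spaces are types of class \<open>real_inner\<close> with a finite spanning set, rather than of class
  \<open>euclidean_space\<close>: the latter requires a nonempty basis and so excludes the zero space.
\<close>

definition finite_dimensional :: "'a::real_vector itself \<Rightarrow> bool" where
  "finite_dimensional _ \<longleftrightarrow> (\<exists>B::'a set. finite B \<and> span B = UNIV)"

text \<open>Continuity of the derivative is with respect to the operator norm on \<open>'a \<Rightarrow>\<^sub>L 'b\<close>.\<close>

definition continuously_differentiable ::
    "('a::real_normed_vector \<Rightarrow> 'b::real_normed_vector) \<Rightarrow> bool" where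
  "continuously_differentiable f \<longleftrightarrow>
     (\<exists>f' :: 'a \<Rightarrow> 'a \<Rightarrow>\<^sub>L 'b.
        (\<forall>x. (f has_derivative blinfun_apply (f' x)) (at x)) \<and> continuous_on UNIV f')"

abbreviation Deriv_at ::
    "('a::real_normed_vector \<Rightarrow> 'b::real_normed_vector) \<Rightarrow> 'a \<Rightarrow> 'a \<Rightarrow> 'b" where
  "Deriv_at f x \<equiv> frechet_derivative f (at x)"

definition gradient :: "('a::real_inner \<Rightarrow> real) \<Rightarrow> 'a \<Rightarrow> 'a" where
  "gradient f x = (THE g. \<forall>d. Deriv_at f x d = g \<bullet> d)"

definition polar_cone :: "'a::real_inner set \<Rightarrow> 'a set" where
  "polar_cone K = {w. \<forall>d\<in>K. w \<bullet> d \<le> 0}"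

definition local_solution ::
    "('a::topological_space \<Rightarrow> real) \<Rightarrow> ('a \<Rightarrow> 'b) \<Rightarrow> 'b set \<Rightarrow> 'a \<Rightarrow> bool" where
  "local_solution f h K x \<longleftrightarrow>
     h x \<in> K \<and> eventually (\<lambda>y. h y \<in> K \<longrightarrow> f x \<le> f y) (nhds x)"

definition robinson_condition ::
    "('a::real_normed_vector \<Rightarrow> 'b::real_normed_vector) \<Rightarrow> 'b set \<Rightarrow> 'a \<Rightarrow> bool" where
  "robinson_condition h K x \<longleftrightarrow>
     0 \<in> interior {Deriv_at h x d + w - h x | d w. w \<in> K}"

end

theory Submission
  imports Defs
begin

text \<open>
  The multiplier is a limit of suitably scaled multipliers of penalised problems. Adding a slack \<open>w \<in> K\<close>, one
  minimises
    \<open>f y + c/2 * \<parallel>h y - w\<parallel>\<^sup>2 + 1/2 * \<parallel>y - x\<parallel>\<^sup>2\<close>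
  jointly over \<open>y\<close> near \<open>x\<close> and \<open>w \<in> K\<close> near \<open>h x\<close>. The slack keeps the objective differentiable
  in \<open>y\<close>: the squared distance to \<open>K\<close> appears only as a minimum over \<open>w\<close>. The last term makes \<open>x\<close> a strict
  local solution, so that the minimisers tend to \<open>(x, h x)\<close> as \<open>c \<rightarrow> \<infinity>\<close> and the localisation
  is eventually inactive (\<open>penalty_sequence\<close>). With \<open>L = c *\<^sub>R (h y - w)\<close>, stationarity in \<open>y\<close>
  reads \<open>\<nabla>f y + Dh y\<^sup>* L + (y - x) = 0\<close>, and minimality in \<open>w\<close> says that \<open>w\<close> is locally a nearest
  point of the cone \<open>K\<close> to \<open>h y\<close>, so that \<open>L\<close> is polar to \<open>K\<close> and orthogonal to \<open>w\<close>.

  The sequence \<open>L\<close> may be unbounded, but after scaling \<open>(1, L)\<close> to size one a subsequence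
  converges, to \<open>(s, m) \<noteq> 0\<close> say. This gives the Fritz John conditions (\<open>fritz_john\<close>). If \<open>s = 0\<close>,
  then \<open>m\<close> is nonzero, annihilates the range of \<open>Dh x\<close>, is orthogonal to \<open>h x\<close> and polar to \<open>K\<close>, so
  \<open>m\<close> is nonpositive on \<open>Dh x X + K - h x\<close>. That set contains a positive multiple of \<open>m\<close> by
  Robinson's condition, which is absurd. Hence \<open>s > 0\<close>, and \<open>m / s\<close> is a multiplier.
\<close>

section \<open>Finite-dimensional inner product spaces\<close>

lemma orthogonal_spanning_set:
  assumes "finite_dimensional TYPE('a::real_inner)"
  obtains C :: "'a::real_inner set" where "finite C" "span C = UNIV" "pairwise orthogonal C"
proof -
  obtain B :: "'a set" where "finite B" "span B = UNIV"
    using assms unfolding finite_dimensional_def by blast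
  then show thesis
    using basis_orthogonal[of B] that by auto
qed

text \<open>
  Induction on the spanning set: by Pythagoras, both components of a vector of norm at most \<open>r\<close>
  with respect to \<open>c\<close> and the span of the remaining vectors have norm at most \<open>r\<close>, so the ball
  lies in the sum of a compact set and a compact segment.
\<close>

lemma bounded_part_of_orthogonal_span_in_compact:
  fixes C :: "'a::real_inner set"
  assumes "finite C" "pairwise orthogonal C"
  shows "\<exists>T. compact T \<and> cball 0 r \<inter> span C \<subseteq> T"
  using assms
proof (induction C rule: finite_induct)
  case empty
  then show ?case by (intro exI[of _ "{0}"]) auto
next
  case (insert c C)
  then obtain T where T: "compact T" "cball 0 r \<inter> span C \<subseteq> T"
    by (auto simp: pairwise_insert)
  have orth: "orthogonal c y" if "y \<in> span C" for y
    using insert.prems insert.hyps that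
    by (intro orthogonal_to_span[of y C]) (auto simp: pairwise_insert)
  define S where "S = (\<lambda>t. t *\<^sub>R c) ` {- r / norm c .. r / norm c}"
  have "compact S"
    unfolding S_def by (intro compact_continuous_image continuous_intros) auto
  moreover have "cball 0 r \<inter> span (insert c C) \<subseteq> {y + z | y z. y \<in> T \<and> z \<in> S}"
  proof
    fix v assume v: "v \<in> cball 0 r \<inter> span (insert c C)"
    then obtain k where k: "v - k *\<^sub>R c \<in> span C"
      by (auto simp: span_breakdown_eq)
    define y where "y = v - k *\<^sub>R c"
    have "orthogonal (k *\<^sub>R c) y"
      using orth[OF k] by (simp add: y_def orthogonal_def)
    then have *: "(norm v)\<^sup>2 = (norm (k *\<^sub>R c))\<^sup>2 + (norm y)\<^sup>2"
      using norm_add_Pythagorean[of "k *\<^sub>R c" y] by (simp add: y_def)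
    have "norm y \<le> norm v" "norm (k *\<^sub>R c) \<le> norm v"
      by (rule power2_le_imp_le; use * in simp)+
    then have y: "y \<in> T" and kc: "\<bar>k\<bar> * norm c \<le> r"
      using v k T(2) by (auto simp: y_def)
    have "k *\<^sub>R c \<in> S"
    proof (cases "c = 0")
      case True
      then show ?thesis by (auto simp: S_def)
    next
      case False
      then have "\<bar>k\<bar> \<le> r / norm c" using kc by (simp add: field_simps)
      then show ?thesis unfolding S_def by (intro imageI) auto
    qed
    then show "v \<in> {y + z | y z. y \<in> T \<and> z \<in> S}"
      using y by (intro CollectI exI[of _ y] exI[of _ "k *\<^sub>R c"]) (simp add: y_def)
  qed
  ultimately show ?case
    using compact_sums[OF T(1)] by blast
qed

lemma finite_dimensional_compact_cball:
  fixes a :: "'a::real_inner"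
  assumes "finite_dimensional TYPE('a)"
  shows "compact (cball a r)"
proof -
  obtain C :: "'a set" where C: "finite C" "span C = UNIV" "pairwise orthogonal C"
    using orthogonal_spanning_set[OF assms] .
  obtain T where T: "compact T" "cball (0::'a) r \<subseteq> T"
    using bounded_part_of_orthogonal_span_in_compact[OF C(1,3), of r] C(2) by auto
  then have "compact (cball (0::'a) r)"
    using compact_Int_closed[OF T(1) closed_cball[of "0::'a" r]] by (simp add: Int_absorb1)
  then have "compact ((+) a ` cball 0 r)"
    by (rule compact_translation)
  then show ?thesis by simp
qed

text \<open>
  The representing vector has the Fourier coefficients \<open>p c / (c \<bullet> c)\<close>. A zero vector in \<open>C\<close>
  contributes nothing, since both \<open>p 0\<close> and the quotient vanish.
\<close>

lemma finite_dimensional_riesz: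
  fixes p :: "'a::real_inner \<Rightarrow> real"
  assumes "finite_dimensional TYPE('a)" "linear p"
  shows "\<exists>g. \<forall>d. p d = g \<bullet> d"
proof -
  obtain C :: "'a set" where C: "finite C" "span C = UNIV" "pairwise orthogonal C"
    using orthogonal_spanning_set[OF assms(1)] .
  define g where "g = (\<Sum>c\<in>C. (p c / (c \<bullet> c)) *\<^sub>R c)"
  have "p c = g \<bullet> c" if "c \<in> C" for c
  proof -
    have "g \<bullet> c = (\<Sum>b\<in>C. if b = c then p c else 0)"
      unfolding g_def inner_sum_left
    proof (rule sum.cong)
      fix b assume "b \<in> C"
      then show "(p b / (b \<bullet> b)) *\<^sub>R b \<bullet> c = (if b = c then p c else 0)"
        using C(3) that linear_0[OF assms(2)] by (auto simp: pairwise_def orthogonal_def)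
    qed simp
    then show ?thesis using C(1) that by simp
  qed
  moreover have "linear (\<lambda>d. g \<bullet> d)"
    by (simp add: bounded_linear.linear bounded_linear_inner_right)
  ultimately have "p d = g \<bullet> d" for d
    using linear_eq_on[OF assms(2), of "\<lambda>d. g \<bullet> d" d C] C(2) by auto
  then show ?thesis by blast
qed

lemma gradient_inner:
  fixes f :: "'a::real_inner \<Rightarrow> real"
  assumes "finite_dimensional TYPE('a)" "f differentiable (at x)"
  shows "gradient f x \<bullet> d = Deriv_at f x d"
proof -
  obtain g where g: "\<And>d. Deriv_at f x d = g \<bullet> d"
    using finite_dimensional_riesz[OF assms(1) linear_frechet_derivative[OF assms(2)]] by blast
  have "gradient f x = g"
    unfolding gradient_def
  proof (rule the_equality)
    fix g' assume "\<forall>d. Deriv_at f x d = g' \<bullet> d"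
    then have "\<forall>d. g' \<bullet> d = g \<bullet> d" using g by simp
    then show "g' = g" by (metis vector_eq_rdot)
  qed (simp add: g)
  then show ?thesis by (simp add: g)
qed

lemma finite_dimensional_adjoint_works:
  fixes A :: "'a::real_inner \<Rightarrow> 'b::real_inner"
  assumes "finite_dimensional TYPE('a)" "linear A"
  shows "A d \<bullet> l = d \<bullet> adjoint A l"
proof -
  have "\<exists>g. \<forall>d. A d \<bullet> l = d \<bullet> g" for l
  proof -
    have "linear (\<lambda>d. A d \<bullet> l)"
      using linear_compose[OF assms(2), of "\<lambda>y. y \<bullet> l"]
      by (simp add: o_def bounded_linear.linear bounded_linear_inner_left)
    from finite_dimensional_riesz[OF assms(1) this] show ?thesis
      by (simp add: inner_commute)
  qed
  then have "\<exists>A'. \<forall>d l. A d \<bullet> l = d \<bullet> A' l"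
    by metis
  then have "\<forall>d l. A d \<bullet> l = d \<bullet> adjoint A l"
    unfolding adjoint_def by (rule someI_ex)
  then show ?thesis by blast
qed

section \<open>Optimality conditions for the penalised problem\<close>

text \<open>
  The first-order condition for a nearest point, along a direction in which the set can be entered.
\<close>

lemma local_nearest_point_direction:
  fixes p w v :: "'a::real_inner"
  assumes near: "\<And>u. u \<in> K \<Longrightarrow> dist u w < e \<Longrightarrow> norm (p - w) \<le> norm (p - u)"
    and "e > 0"
    and feasible: "\<And>t. 0 < t \<Longrightarrow> t \<le> 1 \<Longrightarrow> w + t *\<^sub>R v \<in> K"
  shows "(p - w) \<bullet> v \<le> 0"
proof (rule ccontr)
  assume "\<not> (p - w) \<bullet> v \<le> 0"
  then have a: "(p - w) \<bullet> v > 0" and v: "norm v > 0" by auto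
  \<comment> \<open>The bound on \<open>t\<close> makes the first-order gain \<open>2 * t * ((p - w) \<bullet> v)\<close> beat \<open>t\<^sup>2 * (v \<bullet> v)\<close>.\<close>
  define t where "t = min 1 (min (e / (2 * norm v)) ((p - w) \<bullet> v / (v \<bullet> v)))"
  have t: "t > 0" "t \<le> 1" "t \<le> e / (2 * norm v)" "t \<le> (p - w) \<bullet> v / (v \<bullet> v)"
    using a v \<open>e > 0\<close> by (auto simp: t_def)
  have "dist (w + t *\<^sub>R v) w < e"
    using t(1,3) v \<open>e > 0\<close> by (simp add: dist_norm field_simps)
  then have "norm (p - w) \<le> norm (p - (w + t *\<^sub>R v))"
    using near feasible t(1,2) by blast
  then have "(p - w) \<bullet> (p - w) \<le> (p - w - t *\<^sub>R v) \<bullet> (p - w - t *\<^sub>R v)"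
    by (simp add: norm_le diff_diff_eq)
  also have "\<dots> = (p - w) \<bullet> (p - w) - t * (2 * ((p - w) \<bullet> v) - t * (v \<bullet> v))"
    by (simp add: inner_diff_left inner_diff_right inner_commute algebra_simps)
  finally have "t * (2 * ((p - w) \<bullet> v) - t * (v \<bullet> v)) \<le> 0" by simp
  moreover have "t * (v \<bullet> v) \<le> (p - w) \<bullet> v"
    using t(4) v by (simp add: field_simps)
  ultimately show False
    using t(1) a by (simp add: mult_le_0_iff)
qed

text \<open>
  From \<open>w\<close> one can move within the cone in every direction of \<open>K\<close>, and also in the direction \<open>- w\<close>
  towards the apex; the directions \<open>w\<close> and \<open>- w\<close> together give the orthogonality.
\<close>

lemma local_nearest_point_of_cone:
  fixes p w :: "'a::real_inner"
  assumes K: "convex K" "cone K" "w \<in> K"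
    and near: "\<And>u. u \<in> K \<Longrightarrow> dist u w < e \<Longrightarrow> norm (p - w) \<le> norm (p - u)"
    and "e > 0"
  shows "p - w \<in> polar_cone K" "(p - w) \<bullet> w = 0"
proof -
  note direction = local_nearest_point_direction[of K w e p, OF near \<open>e > 0\<close>]
  have add: "w + t *\<^sub>R v \<in> K" if "v \<in> K" "t > 0" for t v
    using that K convex_cone[of K] by (auto simp: cone_def)
  show "p - w \<in> polar_cone K"
    unfolding polar_cone_def using direction add by blast
  have "w + t *\<^sub>R (- w) \<in> K" if "t \<le> 1" for t
  proof -
    have "w + t *\<^sub>R (- w) = (1 - t) *\<^sub>R w" by (simp add: algebra_simps)
    then show ?thesis using that K unfolding cone_def by auto
  qed
  then have "(p - w) \<bullet> (- w) \<le> 0" using direction by blast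
  moreover have "(p - w) \<bullet> w \<le> 0" using direction add K(3) by blast
  ultimately show "(p - w) \<bullet> w = 0" by simp
qed

definition penalised ::
    "('a::real_inner \<Rightarrow> real) \<Rightarrow> ('a \<Rightarrow> 'b::real_inner) \<Rightarrow> 'a \<Rightarrow> real \<Rightarrow> 'a \<Rightarrow> 'b \<Rightarrow> real" where
  "penalised f h x c y w = f y + c / 2 * ((h y - w) \<bullet> (h y - w)) + 1 / 2 * ((y - x) \<bullet> (y - x))"

lemma penalised_stationary:
  fixes f :: "'a::real_inner \<Rightarrow> real" and h :: "'a \<Rightarrow> 'b::real_inner"
  assumes f: "(f has_derivative f') (at y)" and h: "(h has_derivative h') (at y)"
    and "open S" "y \<in> S"
    and min: "\<And>z. z \<in> S \<Longrightarrow> penalised f h x c y w \<le> penalised f h x c z w"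
  shows "f' d + (c *\<^sub>R (h y - w)) \<bullet> h' d + (y - x) \<bullet> d = 0"
proof -
  let ?D = "\<lambda>d. f' d + (c *\<^sub>R (h y - w)) \<bullet> h' d + (y - x) \<bullet> d"
  have "((\<lambda>z. penalised f h x c z w) has_derivative ?D) (at y)"
    unfolding penalised_def
    by (rule derivative_eq_intros f h | rule refl)+ (auto simp: inner_commute fun_eq_iff algebra_simps)
  from differential_zero_maxmin[OF \<open>y \<in> S\<close> \<open>open S\<close> this] min show ?thesis
    by (auto dest: fun_cong)
qed

section \<open>Convergence of the penalty method\<close>

text \<open>
  The values of the minimisers do not exceed the value \<open>f x\<close> at \<open>(x, h x)\<close>, so the penalty forces
  a cluster point \<open>(x', w')\<close> to satisfy \<open>h x' = w' \<in> B\<close>. Then optimality of \<open>x\<close> gives \<open>f x \<le> f x'\<close>, while \<open>f x' + \<parallel>x' - x\<parallel>\<^sup>2 / 2 \<le> f x\<close>. Hence \<open>x' = x\<close>.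
\<close>

lemma penalised_minimisers_converge:
  fixes f :: "'a::real_inner \<Rightarrow> real" and h :: "'a \<Rightarrow> 'b::real_inner"
  assumes cont: "continuous_on UNIV f" "continuous_on UNIV h"
    and A: "compact A" "x \<in> A" and B: "compact B" "h x \<in> B"
    and opt: "\<And>y. y \<in> A \<Longrightarrow> h y \<in> B \<Longrightarrow> f x \<le> f y"
  obtains X W and c :: "nat \<Rightarrow> real" where
    "X \<longlonglongrightarrow> x" "W \<longlonglongrightarrow> h x" "\<And>n. c n > 0" "\<And>n. X n \<in> A" "\<And>n. W n \<in> B"
    "\<And>n y w. y \<in> A \<Longrightarrow> w \<in> B \<Longrightarrow> penalised f h x (c n) (X n) (W n) \<le> penalised f h x (c n) y w"
proof -
  have "\<exists>z\<in>A \<times> B. \<forall>z'\<in>A \<times> B. penalised f h x (real (Suc n)) (fst z) (snd z)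
      \<le> penalised f h x (real (Suc n)) (fst z') (snd z')" for n
    unfolding penalised_def using A B
    by (intro continuous_attains_inf compact_Times continuous_intros
        continuous_on_compose2[OF cont(1)] continuous_on_compose2[OF cont(2)]) auto
  then obtain Z where Z: "\<And>n. Z n \<in> A \<times> B"
    and Zmin: "\<And>n z'. z' \<in> A \<times> B \<Longrightarrow> penalised f h x (real (Suc n)) (fst (Z n)) (snd (Z n))
      \<le> penalised f h x (real (Suc n)) (fst z') (snd z')"
    by metis
  obtain l r where l: "l \<in> A \<times> B" and r: "strict_mono r" and lim: "(Z \<circ> r) \<longlonglongrightarrow> l"
    using compact_Times[OF A(1) B(1)] Z unfolding compact_def by metis
  define X W where "X = (\<lambda>n. fst (Z (r n)))" and "W = (\<lambda>n. snd (Z (r n)))"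
  define c where "c = (\<lambda>n. real (Suc (r n)))"
  have X: "X \<longlonglongrightarrow> fst l" and W: "W \<longlonglongrightarrow> snd l"
    using tendsto_fst[OF lim] tendsto_snd[OF lim] by (simp_all add: X_def W_def o_def)
  have fX: "(\<lambda>n. f (X n)) \<longlonglongrightarrow> f (fst l)" and hX: "(\<lambda>n. h (X n)) \<longlonglongrightarrow> h (fst l)"
    using cont X by (auto intro: continuous_on_tendsto_compose)
  have min: "penalised f h x (c n) (X n) (W n) \<le> penalised f h x (c n) y w"
    if "y \<in> A" "w \<in> B" for n y w
    using Zmin[of "(y, w)" "r n"] that by (simp add: X_def W_def c_def)
  have c: "c n > 0" for n by (simp add: c_def)
  have le: "f (X n) + c n / 2 * ((h (X n) - W n) \<bullet> (h (X n) - W n))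
      + 1 / 2 * ((X n - x) \<bullet> (X n - x)) \<le> f x" for n
    using min[OF A(2) B(2), of n] by (simp add: penalised_def)
  have le1: "f (X n) + 1 / 2 * ((X n - x) \<bullet> (X n - x)) \<le> f x" for n
  proof -
    have "0 \<le> c n / 2 * ((h (X n) - W n) \<bullet> (h (X n) - W n))"
      using c[of n] by simp
    then show ?thesis using le[of n] by linarith
  qed
  have le2: "(h (X n) - W n) \<bullet> (h (X n) - W n) \<le> 2 * (f x - f (X n)) * (1 / c n)" for n
  proof -
    have "0 \<le> (X n - x) \<bullet> (X n - x)" by simp
    then have "c n / 2 * ((h (X n) - W n) \<bullet> (h (X n) - W n)) \<le> f x - f (X n)"
      using le[of n] by linarith
    then show ?thesis using c[of n] by (simp add: field_simps)
  qed
  have "(\<lambda>n. 1 / c n) \<longlonglongrightarrow> 0"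
    using LIMSEQ_subseq_LIMSEQ[OF LIMSEQ_inverse_real_of_nat r]
    by (simp add: c_def o_def inverse_eq_divide)
  then have "(\<lambda>n. 2 * (f x - f (X n)) * (1 / c n)) \<longlonglongrightarrow> 2 * (f x - f (fst l)) * 0"
    by (intro tendsto_intros fX)
  moreover have "(\<lambda>n. (h (X n) - W n) \<bullet> (h (X n) - W n))
      \<longlonglongrightarrow> (h (fst l) - snd l) \<bullet> (h (fst l) - snd l)"
    by (intro tendsto_intros hX W)
  ultimately have "(h (fst l) - snd l) \<bullet> (h (fst l) - snd l) \<le> 2 * (f x - f (fst l)) * 0"
    using le2 by (blast intro: LIMSEQ_le)
  then have hl: "h (fst l) = snd l"
    using inner_gt_zero_iff[of "h (fst l) - snd l"] by (simp del: inner_gt_zero_iff)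
  have "f (fst l) + 1 / 2 * ((fst l - x) \<bullet> (fst l - x)) \<le> f x"
    by (rule LIMSEQ_le_const2[of "\<lambda>n. f (X n) + 1 / 2 * ((X n - x) \<bullet> (X n - x))"])
      (use le1 in \<open>auto intro!: tendsto_intros fX X\<close>)
  moreover have "f x \<le> f (fst l)"
    using opt l hl by (auto simp: mem_Times_iff)
  ultimately have "(fst l - x) \<bullet> (fst l - x) \<le> 0" by simp
  then have xl: "fst l = x"
    using inner_gt_zero_iff[of "fst l - x"] by (simp del: inner_gt_zero_iff)
  show thesis
  proof (rule that[of X W c])
    show "X n \<in> A" "W n \<in> B" for n
      using Z[of "r n"] by (auto simp: X_def W_def mem_Times_iff)
  qed (use X W xl hl c min in auto)
qed

lemma penalty_sequence:
  fixes f :: "'x::real_inner \<Rightarrow> real" and h :: "'x \<Rightarrow> 'y::real_inner"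
  assumes fin: "finite_dimensional TYPE('x)" "finite_dimensional TYPE('y)"
    and K: "closed K" "convex K" "cone K"
    and f: "\<And>y. (f has_derivative f' y) (at y)"
    and h: "\<And>y. (h has_derivative h' y) (at y)"
    and sol: "local_solution f h K x"
  obtains X W L where "X \<longlonglongrightarrow> x" "W \<longlonglongrightarrow> h x"
    "\<And>n d. f' (X n) d + L n \<bullet> h' (X n) d + (X n - x) \<bullet> d = 0"
    "\<And>n. L n \<in> polar_cone K" "\<And>n. L n \<bullet> W n = 0"
proof -
  have cont: "continuous_on UNIV f" "continuous_on UNIV h"
    using f h by (auto intro!: continuous_at_imp_continuous_on has_derivative_continuous)
  obtain e where e: "e > 0" and opt: "\<And>y. dist y x < e \<Longrightarrow> h y \<in> K \<Longrightarrow> f x \<le> f y"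
    and hK: "h x \<in> K"
    using sol unfolding local_solution_def eventually_nhds_metric by blast
  define A B where "A = cball x (e / 2)" and "B = cball (h x) 1 \<inter> K"
  have "compact A" "x \<in> A" "compact B" "h x \<in> B"
    unfolding A_def B_def
    using finite_dimensional_compact_cball[OF fin(1)] finite_dimensional_compact_cball[OF fin(2)]
      K(1) e hK by (auto intro: compact_Int_closed)
  moreover have "f x \<le> f y" if "y \<in> A" "h y \<in> B" for y
    using that e opt[of y] by (auto simp: A_def B_def dist_commute)
  ultimately obtain X W c where lim: "X \<longlonglongrightarrow> x" "W \<longlonglongrightarrow> h x" and c: "\<And>n. c n > 0"
    and W: "\<And>n. W n \<in> B"
    and min: "\<And>n y w. y \<in> A \<Longrightarrow> w \<in> B \<Longrightarrow>
        penalised f h x (c n) (X n) (W n) \<le> penalised f h x (c n) y w"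
    and X: "\<And>n. X n \<in> A"
    using penalised_minimisers_converge[OF cont, of A x B] by metis
  have "\<forall>\<^sub>F n in sequentially. dist (X n) x < e / 2 \<and> dist (W n) (h x) < 1"
    using e by (intro eventually_conj tendstoD[OF lim(1)] tendstoD[OF lim(2)]) auto
  then obtain N where N: "\<And>n. n \<ge> N \<Longrightarrow> dist (X n) x < e / 2" "\<And>n. n \<ge> N \<Longrightarrow> dist (W n) (h x) < 1"
    by (auto simp: eventually_sequentially)
  define L where "L n = c n *\<^sub>R (h (X n) - W n)" for n
  have stationary: "f' (X n) d + L n \<bullet> h' (X n) d + (X n - x) \<bullet> d = 0" if "n \<ge> N" for n d
    unfolding L_def
  proof (rule penalised_stationary[OF f h, of "ball x (e / 2)"])
    show "X n \<in> ball x (e / 2)"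
      using N(1)[OF that] by (simp add: dist_commute)
    show "penalised f h x (c n) (X n) (W n) \<le> penalised f h x (c n) z (W n)"
      if "z \<in> ball x (e / 2)" for z
      using that W min by (auto simp: A_def)
  qed auto
  have polar: "L n \<in> polar_cone K" "L n \<bullet> W n = 0" if "n \<ge> N" for n
  proof -
    \<comment> \<open>The radius keeps \<open>u\<close> in the unit ball about \<open>h x\<close> over which the slack is minimised.\<close>
    have near: "norm (h (X n) - W n) \<le> norm (h (X n) - u)"
      if u: "u \<in> K" "dist u (W n) < 1 - dist (W n) (h x)" for u
    proof -
      have "dist (h x) u \<le> 1"
        using u(2) dist_triangle[of u "h x" "W n"] by (simp add: dist_commute)
      then have "penalised f h x (c n) (X n) (W n) \<le> penalised f h x (c n) (X n) u"
        using u(1) X min by (auto simp: B_def)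
      then show ?thesis
        using c[of n] by (simp add: penalised_def norm_le)
    qed
    have "W n \<in> K" using W[of n] by (simp add: B_def)
    from local_nearest_point_of_cone[OF K(2,3) this near] N(2)[OF that]
    have *: "h (X n) - W n \<in> polar_cone K" "(h (X n) - W n) \<bullet> W n = 0" by auto
    then show "L n \<bullet> W n = 0" by (simp add: L_def)
    show "L n \<in> polar_cone K"
      using *(1) c[of n] by (auto simp: L_def polar_cone_def mult_le_0_iff)
  qed
  \<comment> \<open>Dropping the first \<open>N\<close> terms, where the localisation may still be active.\<close>
  show thesis
    by (rule that[of "\<lambda>n. X (n + N)" "\<lambda>n. W (n + N)" "\<lambda>n. L (n + N)"])
      (use lim polar stationary in \<open>auto intro: LIMSEQ_ignore_initial_segment\<close>)
qed

section \<open>Fritz John conditions and the multiplier\<close>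

lemma fritz_john:
  fixes f :: "'x::real_inner \<Rightarrow> real" and h :: "'x \<Rightarrow> 'y::real_inner"
  assumes fin: "finite_dimensional TYPE('x)" "finite_dimensional TYPE('y)"
    and K: "closed K" "convex K" "cone K"
    and f: "continuously_differentiable f"
    and h: "continuously_differentiable h"
    and sol: "local_solution f h K x"
  obtains s m where "s \<ge> 0" "s + norm m = 1" "m \<in> polar_cone K" "h x \<bullet> m = 0"
    "\<And>d. s * Deriv_at f x d + m \<bullet> Deriv_at h x d = 0"
proof -
  obtain f' where f': "\<And>y. (f has_derivative blinfun_apply (f' y)) (at y)" "continuous_on UNIV f'"
    using f unfolding continuously_differentiable_def by blast
  obtain h' where h': "\<And>y. (h has_derivative blinfun_apply (h' y)) (at y)" "continuous_on UNIV h'"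
    using h unfolding continuously_differentiable_def by blast
  obtain X W L where X: "X \<longlonglongrightarrow> x" and W: "W \<longlonglongrightarrow> h x"
    and stationary: "\<And>n d. f' (X n) d + L n \<bullet> h' (X n) d + (X n - x) \<bullet> d = 0"
    and polar: "\<And>n. L n \<in> polar_cone K" "\<And>n. L n \<bullet> W n = 0"
    using penalty_sequence[OF fin K f'(1) h'(1) sol] by metis
  \<comment> \<open>Unlike the multipliers themselves, the scaled pairs \<open>(s n, M n)\<close> stay in a compact set.\<close>
  define s where "s n = 1 / (1 + norm (L n))" for n
  define M where "M n = s n *\<^sub>R L n" for n
  have s: "s n > 0" for n by (simp add: s_def add_pos_nonneg)
  have sum: "s n + norm (M n) = 1" for n
  proof -
    have "1 + norm (L n) > 0" by (simp add: add_pos_nonneg)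
    then show ?thesis by (simp add: M_def s_def field_simps)
  qed
  have M: "s n * f' (X n) d + M n \<bullet> h' (X n) d + s n * ((X n - x) \<bullet> d) = 0" for n d
    using arg_cong[OF stationary[of n d], of "(*) (s n)"] by (simp add: M_def algebra_simps)
  have "(s n, M n) \<in> {0..1} \<times> cball 0 1" for n
    using s[of n] sum[of n] norm_ge_zero[of "M n"] by (auto simp del: norm_ge_zero)
  then have sM: "\<forall>n. (s n, M n) \<in> {0..1} \<times> cball 0 1" by blast
  have "compact ({0..1::real} \<times> cball (0::'y) 1)"
    by (intro compact_Times finite_dimensional_compact_cball fin) simp
  then obtain l r where r: "strict_mono r" and lim: "((\<lambda>n. (s n, M n)) \<circ> r) \<longlonglongrightarrow> l"
    using sM unfolding compact_def by (elim allE[of _ "\<lambda>n. (s n, M n)"]) blast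
  have slim: "(\<lambda>n. s (r n)) \<longlonglongrightarrow> fst l" and Mlim: "(\<lambda>n. M (r n)) \<longlonglongrightarrow> snd l"
    using tendsto_fst[OF lim] tendsto_snd[OF lim] by (simp_all add: o_def)
  have Xr: "(\<lambda>n. X (r n)) \<longlonglongrightarrow> x" and Wr: "(\<lambda>n. W (r n)) \<longlonglongrightarrow> h x"
    using LIMSEQ_subseq_LIMSEQ[OF X r] LIMSEQ_subseq_LIMSEQ[OF W r] by (simp_all add: o_def)
  have D: "Deriv_at f x = f' x" "Deriv_at h x = h' x"
    using frechet_derivative_at[OF f'(1)] frechet_derivative_at[OF h'(1)] by auto
  show thesis
  proof (rule that[of "fst l" "snd l"])
    show "fst l \<ge> 0"
      by (rule LIMSEQ_le_const[OF slim]) (use s in \<open>auto intro: less_imp_le\<close>)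
    have "(\<lambda>n. s (r n) + norm (M (r n))) \<longlonglongrightarrow> fst l + norm (snd l)"
      by (intro tendsto_intros slim Mlim)
    then show "fst l + norm (snd l) = 1" by (simp add: sum LIMSEQ_const_iff)
    have "M n \<bullet> w \<le> 0" if "w \<in> K" for n w
      using polar(1)[of n] s[of n] that by (auto simp: M_def polar_cone_def mult_le_0_iff)
    then have "snd l \<bullet> w \<le> 0" if "w \<in> K" for w
      using that by (intro LIMSEQ_le_const2[of "\<lambda>n. M (r n) \<bullet> w"] tendsto_intros Mlim) auto
    then show "snd l \<in> polar_cone K" by (simp add: polar_cone_def)
    have "(\<lambda>n. M (r n) \<bullet> W (r n)) \<longlonglongrightarrow> snd l \<bullet> h x"
      by (intro tendsto_intros Mlim Wr)
    then show "h x \<bullet> snd l = 0"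
      by (simp add: M_def polar(2) LIMSEQ_const_iff inner_commute)
    fix d
    have "(\<lambda>n. f' (X (r n))) \<longlonglongrightarrow> f' x" "(\<lambda>n. h' (X (r n))) \<longlonglongrightarrow> h' x"
      using f'(2) h'(2) Xr by (auto intro: continuous_on_tendsto_compose)
    then have "(\<lambda>n. s (r n) * f' (X (r n)) d + M (r n) \<bullet> h' (X (r n)) d
          + s (r n) * ((X (r n) - x) \<bullet> d))
        \<longlonglongrightarrow> fst l * f' x d + snd l \<bullet> h' x d + fst l * ((x - x) \<bullet> d)"
      by (intro tendsto_intros slim Mlim Xr)
    then show "fst l * Deriv_at f x d + snd l \<bullet> Deriv_at h x d = 0"
      by (simp add: M D LIMSEQ_const_iff)
  qed
qed

text \<open>
  The first-order term in the Fritz John conditions cannot vanish under Robinson's condition: the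
  functional \<open>m\<close> is nonpositive on a neighbourhood of \<open>0\<close>, hence zero.
\<close>

lemma robinson_condition_imp_no_singular_multiplier:
  fixes h :: "'x::real_inner \<Rightarrow> 'y::real_inner"
  assumes "robinson_condition h K x"
    and polar: "m \<in> polar_cone K" and compl: "h x \<bullet> m = 0"
    and ann: "\<And>d. m \<bullet> Deriv_at h x d = 0"
  shows "m = 0"
proof (rule ccontr)
  assume "m \<noteq> 0"
  obtain e where e: "e > 0" and ball: "ball 0 e \<subseteq> {Deriv_at h x d + w - h x | d w. w \<in> K}"
    using assms(1) unfolding robinson_condition_def mem_interior by blast
  define t where "t = e / (2 * norm m)"
  have t: "t > 0" using e \<open>m \<noteq> 0\<close> by (simp add: t_def)
  have "t *\<^sub>R m \<in> ball 0 e"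
    using e \<open>m \<noteq> 0\<close> by (simp add: t_def)
  then obtain d w where "w \<in> K" and eq: "t *\<^sub>R m = Deriv_at h x d + w - h x"
    using ball by blast
  have "t * (m \<bullet> m) = m \<bullet> (t *\<^sub>R m)" by simp
  also have "\<dots> = m \<bullet> w"
    unfolding eq using ann[of d] compl by (simp add: inner_diff_right inner_add_right inner_commute)
  also have "\<dots> \<le> 0"
    using polar \<open>w \<in> K\<close> by (simp add: polar_cone_def)
  finally have "m \<bullet> m \<le> 0"
    using t by (simp add: mult_le_0_iff)
  then show False
    using \<open>m \<noteq> 0\<close> inner_gt_zero_iff[of m] by linarith
qed

theorem theorem2:
  fixes f :: "'x::real_inner \<Rightarrow> real"
    and h :: "'x \<Rightarrow> 'y::real_inner"
    and K :: "'y set"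
    and x :: 'x
  assumes "finite_dimensional TYPE('x)"
    and "finite_dimensional TYPE('y)"
    and "closed K" and "convex K" and "cone K"
    and "continuously_differentiable f"
    and "continuously_differentiable h"
    and "local_solution f h K x"
    and "robinson_condition h K x"
  shows "\<exists>l::'y. gradient f x + adjoint (Deriv_at h x) l = 0
                \<and> h x \<bullet> l = 0
                \<and> l \<in> polar_cone K"
proof -
  obtain s m where s: "s \<ge> 0" "s + norm m = 1" and m: "m \<in> polar_cone K" "h x \<bullet> m = 0"
    and D: "\<And>d. s * Deriv_at f x d + m \<bullet> Deriv_at h x d = 0"
    using fritz_john[OF assms(1-8)] by metis
  have "s \<noteq> 0"
    using robinson_condition_imp_no_singular_multiplier[OF assms(9) m] D s(2) by fastforce
  then have "s > 0" using s(1) by simp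
  define l where "l = m /\<^sub>R s"
  have diff: "f differentiable (at x)" "h differentiable (at x)"
    using assms(6,7) by (auto simp: continuously_differentiable_def differentiable_def)
  have "(gradient f x + adjoint (Deriv_at h x) l) \<bullet> d = 0" for d
  proof -
    have "(gradient f x + adjoint (Deriv_at h x) l) \<bullet> d = Deriv_at f x d + l \<bullet> Deriv_at h x d"
      using gradient_inner[OF assms(1) diff(1)]
        finite_dimensional_adjoint_works[OF assms(1) linear_frechet_derivative[OF diff(2)]]
      by (simp add: inner_add_left inner_add_right inner_commute)
    also have "\<dots> = (s * Deriv_at f x d + m \<bullet> Deriv_at h x d) / s"
      using \<open>s > 0\<close> by (simp add: l_def field_simps)
    finally show ?thesis by (simp add: D)
  qed
  then have "gradient f x + adjoint (Deriv_at h x) l = 0"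
    by (metis inner_eq_zero_iff)
  moreover have "h x \<bullet> l = 0" using m(2) by (simp add: l_def)
  moreover have "l \<in> polar_cone K"
    using m(1) \<open>s > 0\<close> by (auto simp: l_def polar_cone_def mult_le_0_iff)
  ultimately show ?thesis by blast
qed

end
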